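(* Let $p_1,p_2$ and $q_1,q_2$ be pairs of distinct nonisotropic nonorthogonal points of $\mathbb PV$ and let $\alpha_1,\alpha_2\in\mathbb S^1\setminus\Omega$ be parameters. Assume that the complex line $\mathrm L(p_1,p_2)$ is noneuclidean and that $\sigma p_i=\sigma q_i$, $i=1,2$. The relation $R_{\alpha_2}^{p_2}R_{\alpha_1}^{p_1}=R_{\alpha_2}^{q_2}R_{\alpha_1}^{q_1}$ implies that there exists $s\in\mathbb R$ such that $B(s)p_1=q_1$ and $B(s)p_2=q_2$ in $\mathbb PV$, where $B:\mathbb R\to\mathrm{SU}(2,1)$ is the bending one-parameter subgroup of $R_{\alpha_2}^{p_2}R_{\alpha_1}^{p_1}$.
   Context: Let $V$ be a 3-dimensional complex vector space with a Hermitian form $\langle-,-\rangle$ (linear in the first argument) of signature $++-$. The same letter denotes a point of $\mathbb PV$ and a representative. A point $p$ has signature $\sigma p\in\{-1,0,1\}$, the sign of $\langle p,p\rangle$ (negative, isotropic, positive). $\mathrm{SU}(2,1)$ is the group of determinant $1$ linear automorphisms of $V$ preserving the form; its elements are called isometries and their fixed points are the points of $\mathbb PV$ given by eigenvectors. $\mathbb S^1\subset\mathbb C$ is the unit circle and $\Omega$ the set of cube roots of unity. For nonisotropic $p$ and $\alpha\in\mathbb S^1$, $R_\alpha^p\in\mathrm{SU}(2,1)$ is $x\mapsto(\alpha^{-2}-\alpha)\frac{\langle x,p\rangle}{\langle p,p\rangle}p+\alpha x$. $\mathrm L(p_1,p_2)$ is the complex projective line through $p_1\neq p_2$; a line $\mathbb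 PW$ is noneuclidean if the form on $W$ is nondegenerate, and its polar point is $\mathbb PW^\perp$. Bending subgroup. For distinct nonisotropic nonorthogonal $p_1,p_2$ with $L=\mathrm L(p_1,p_2)$ noneuclidean and parameters $\alpha_1,\alpha_2$, let $R=R_{\alpha_2}^{p_2}R_{\alpha_1}^{p_1}$ and let $c$ be the polar point of $L$. The bending one-parameter subgroup $B:\mathbb R\to\mathrm{SU}(2,1)$ of $R$ is: if $R$ is elliptic (has a negative fixed point), with fixed points $x,\tilde x\in L$, $\langle x,\tilde x\rangle=0$, then $B(s)=\mathrm{diag}(1,e^{is/2},e^{-is/2})$ in the basis $c,x,\tilde x$; if $R$ is loxodromic (no negative and exactly two isotropic fixed points $v_1,v_2\in L$), then $B(s)=\mathrm{diag}(1,e^s,e^{-s})$ in the basis $c,v_1,v_2$; if $R$ is parabolic (no negative and a single isotropic fixed point $v_1\in L$), choose an isotropic $v_2\in L$, $v_2\ne v_1$, with representatives such that $\langle v_1,v_2\rangle\in\mathbb R$, and let $B(s)c=c$, $B(s)v_1=v_1$, $B(s)v_2=isv_1+v_2$. *)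

theory Defs
  imports "HOL-Analysis.Analysis"
begin

text \<open>
  The 3-dimensional complex vector space is \<open>complex^3\<close>, equipped with an arbitrary
  Hermitian form \<open>h\<close> of signature \<open>++-\<close>. Operations on projective points are defined on
  representatives (nonzero vectors).
\<close>

type_synonym cvec = "complex^3"
type_synonym cform = "cvec \<Rightarrow> cvec \<Rightarrow> complex"

definition hermitian_form :: "cform \<Rightarrow> bool" where
  "hermitian_form h \<longleftrightarrow>
     (\<forall>x y z. h (x + y) z = h x z + h y z) \<and>
     (\<forall>k x y. h (k *s x) y = k * h x y) \<and>
     (\<forall>x y. h y x = cnj (h x y))"

definition signature_ppm :: "cform \<Rightarrow> bool" where
  "signature_ppm h \<longleftrightarrow>
     (\<exists>e1 e2 e3. vec.span {e1, e2, e3} = UNIV \<and>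
        h e1 e1 = 1 \<and> h e2 e2 = 1 \<and> h e3 e3 = -1 \<and>
        h e1 e2 = 0 \<and> h e1 e3 = 0 \<and> h e2 e3 = 0)"

text \<open>The point of the projective plane represented by a nonzero vector.\<close>

definition proj :: "cvec \<Rightarrow> cvec set" where
  "proj v = vec.span {v}"

text \<open>For a Hermitian form \<open>h p p\<close> is real, and the sign does not depend on the representative.\<close>

definition sig :: "cform \<Rightarrow> cvec \<Rightarrow> real" where
  "sig h p = sgn (Re (h p p))"

definition SU21 :: "cform \<Rightarrow> (cvec \<Rightarrow> cvec) set" where
  "SU21 h = {f. Vector_Spaces.linear (*s) (*s) f \<and> det (matrix f) = 1 \<and>
                (\<forall>x y. h (f x) (f y) = h x y)}"

definition fixed_point :: "(cvec \<Rightarrow> cvec) \<Rightarrow> cvec \<Rightarrow> bool" where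
  "fixed_point f v \<longleftrightarrow> v \<noteq> 0 \<and> (\<exists>k. f v = k *s v)"

definition R_iso :: "cform \<Rightarrow> complex \<Rightarrow> cvec \<Rightarrow> cvec \<Rightarrow> cvec" where
  "R_iso h \<alpha> p x = ((\<alpha> powi (-2) - \<alpha>) * (h x p / h p p)) *s p + \<alpha> *s x"

text \<open>A projective line is represented by the underlying 2-dimensional subspace.\<close>

definition cline :: "cvec \<Rightarrow> cvec \<Rightarrow> cvec set" where
  "cline p1 p2 = vec.span {p1, p2}"

definition orth :: "cform \<Rightarrow> cvec set \<Rightarrow> cvec set" where
  "orth h W = {x. \<forall>w\<in>W. h x w = 0}"

definition noneuclidean :: "cform \<Rightarrow> cvec set \<Rightarrow> bool" where
  "noneuclidean h W \<longleftrightarrow> (\<forall>w\<in>W. (\<forall>u\<in>W. h w u = 0) \<longrightarrow> w = 0)"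

definition elliptic :: "cform \<Rightarrow> (cvec \<Rightarrow> cvec) \<Rightarrow> bool" where
  "elliptic h f \<longleftrightarrow> (\<exists>v. fixed_point f v \<and> sig h v = -1)"

definition isotropic_fixed_points :: "cform \<Rightarrow> (cvec \<Rightarrow> cvec) \<Rightarrow> cvec set set" where
  "isotropic_fixed_points h f = {proj v | v. fixed_point f v \<and> sig h v = 0}"

definition loxodromic :: "cform \<Rightarrow> (cvec \<Rightarrow> cvec) \<Rightarrow> bool" where
  "loxodromic h f \<longleftrightarrow> \<not> elliptic h f \<and> card (isotropic_fixed_points h f) = 2"

definition parabolic :: "cform \<Rightarrow> (cvec \<Rightarrow> cvec) \<Rightarrow> bool" where
  "parabolic h f \<longleftrightarrow> \<not> elliptic h f \<and> card (isotropic_fixed_points h f) = 1"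

text \<open>
  \<open>bending_subgroup h \<alpha>1 p1 \<alpha>2 p2 B\<close>: \<open>B\<close> is the bending one-parameter subgroup of
  \<open>R = R_iso h \<alpha>2 p2 \<circ> R_iso h \<alpha>1 p1\<close>. It is a relation because the construction involves
  choices (the order of the fixed points, and \<open>v2\<close> and the representatives in the parabolic
  case) which affect \<open>B\<close> only by a linear change \<open>s \<mapsto> a s\<close> of the parameter, \<open>a \<noteq> 0\<close>.
\<close>

definition bending_subgroup ::
  "cform \<Rightarrow> complex \<Rightarrow> cvec \<Rightarrow> complex \<Rightarrow> cvec \<Rightarrow> (real \<Rightarrow> cvec \<Rightarrow> cvec) \<Rightarrow> bool" where
  "bending_subgroup h \<alpha>1 p1 \<alpha>2 p2 B \<longleftrightarrow>
    (let R = R_iso h \<alpha>2 p2 \<circ> R_iso h \<alpha>1 p1; L = cline p1 p2 in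
      (\<forall>s. B s \<in> SU21 h) \<and>
      (\<exists>c. c \<noteq> 0 \<and> c \<in> orth h L \<and> (\<forall>s. B s c = c) \<and>
        ((elliptic h R \<and>
            (\<exists>x y. x \<in> L \<and> y \<in> L \<and> fixed_point R x \<and> fixed_point R y \<and> h x y = 0 \<and>
               (\<forall>s. B s x = cis (s / 2) *s x \<and> B s y = cis (- s / 2) *s y)))
        \<or> (loxodromic h R \<and>
            (\<exists>v1 v2. v1 \<in> L \<and> v2 \<in> L \<and> fixed_point R v1 \<and> fixed_point R v2 \<and>
               sig h v1 = 0 \<and> sig h v2 = 0 \<and> proj v1 \<noteq> proj v2 \<and>
               (\<forall>s. B s v1 = complex_of_real (exp s) *s v1 \<and>
                    B s v2 = complex_of_real (exp (- s)) *s v2)))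
        \<or> (parabolic h R \<and>
            (\<exists>v1 v2. v1 \<in> L \<and> v2 \<in> L \<and> fixed_point R v1 \<and> sig h v1 = 0 \<and>
               v2 \<noteq> 0 \<and> sig h v2 = 0 \<and> proj v2 \<noteq> proj v1 \<and> h v1 v2 \<in> \<real> \<and>
               (\<forall>s. B s v1 = v1 \<and> B s v2 = (\<i> * complex_of_real s) *s v1 + v2))))))"

end

theory Submission
  imports Defs
begin

text \<open>
  The trace of \<open>R = R\<^sub>2 R\<^sub>1\<close> determines \<open>\<langle>p\<^sub>1, p\<^sub>2\<rangle>\<langle>p\<^sub>2, p\<^sub>1\<rangle> / (\<langle>p\<^sub>1, p\<^sub>1\<rangle>\<langle>p\<^sub>2, p\<^sub>2\<rangle>)\<close>, and the image of
  \<open>R - \<alpha>\<^sub>1\<alpha>\<^sub>2\<close> determines the line \<open>L\<close>. Hence \<open>q\<^sub>1, q\<^sub>2\<close> lie on \<open>L\<close> and, after rescaling, have the same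
  Gram matrix as \<open>p\<^sub>1, p\<^sub>2\<close>, so some isometry \<open>g\<close> of \<open>L\<close> maps \<open>p\<^sub>i\<close> to \<open>q\<^sub>i\<close>. It conjugates \<open>R\<close> to
  itself. As \<open>R\<close> is not scalar on \<open>L\<close>, an isometry of \<open>L\<close> commuting with \<open>R\<close> is a scalar multiple
  of some \<open>B s\<close>.
\<close>

section \<open>Independent pairs and the planes they span\<close>

lemma mem_span_pair_iff:
  fixes u w z :: cvec
  shows "z \<in> vec.span {u, w} \<longleftrightarrow> (\<exists>a b. z = a *s u + b *s w)"
proof -
  have "z \<in> vec.span {u, w} \<longleftrightarrow> (\<exists>a. z - a *s u \<in> vec.span {w})"
    by (simp add: vec.span_insert)
  also have "\<dots> \<longleftrightarrow> (\<exists>a b. z - a *s u = b *s w)"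
    by (auto simp: vec.span_singleton)
  finally show ?thesis
    by (metis add.commute add_diff_cancel_right' diff_add_cancel)
qed

text \<open>Turns distinctness of projective points into linear independence of representatives; a
  dependence would be a nonzero multiple, hence the same point.\<close>

lemma independent_pairI:
  fixes u w :: cvec
  assumes "u \<noteq> 0" "w \<noteq> 0" "proj u \<noteq> proj w"
  shows "vec.independent {u, w}" "u \<noteq> w"
proof -
  show "u \<noteq> w" using assms by auto
  have "u \<notin> vec.span {w}"
  proof
    assume "u \<in> vec.span {w}"
    then obtain k where k: "u = k *s w" by (auto simp: vec.span_singleton)
    then have "k \<noteq> 0" using assms(1) by auto
    then have "w = inverse k *s u" by (simp add: k vector_smult_assoc)
    then have "vec.span {u} = vec.span {w}"
      using k by (intro vec.span_eq[THEN iffD2]) (auto simp: vec.span_singleton)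
    then show False using assms(3) by (simp add: proj_def)
  qed
  then show "vec.independent {u, w}"
    using assms by (simp add: vec.independent_insert vec.dependent_single)
qed

lemma independent_pair_zero:
  fixes u w :: cvec
  assumes "vec.independent {u, w}" "u \<noteq> w" "a *s u + b *s w = 0"
  shows "a = 0 \<and> b = 0"
proof -
  have "(\<Sum>v\<in>{u, w}. (if v = u then a else b) *s v) = 0"
    using assms(2,3) by simp
  then have "\<forall>v\<in>{u, w}. (if v = u then a else b) = 0"
    using assms(1) vec.independentD[of "{u, w}" "{u, w}" "\<lambda>v. if v = u then a else b"]
    by blast
  then show ?thesis using assms(2) by auto
qed

lemma independent_pair_eq:
  fixes u w :: cvec
  assumes "vec.independent {u, w}" "u \<noteq> w" "a *s u + b *s w = c *s u + d *s w"
  shows "a = c \<and> b = d"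
proof -
  have "(a - c) *s u + (b - d) *s w = 0"
    using assms(3) by (simp add: vec.scale_left_diff_distrib algebra_simps)
  from independent_pair_zero[OF assms(1,2) this] show ?thesis by simp
qed

lemma proj_smult:
  assumes "k \<noteq> 0"
  shows "proj (k *s v) = proj v"
proof -
  have "v = inverse k *s (k *s v)" using assms by (simp add: vector_smult_assoc)
  then show ?thesis unfolding proj_def
    by (intro vec.span_eq[THEN iffD2]) (auto simp: vec.span_singleton)
qed

text \<open>A dimension count: the larger span has dimension at most 2. It lets the line be
  described by the eigenvectors of \<open>R\<close> instead of \<open>p1, p2\<close>.\<close>

lemma span_pair_eq:
  fixes u w p1 p2 :: cvec
  assumes "vec.independent {u, w}" "u \<noteq> w" "u \<in> vec.span {p1, p2}" "w \<in> vec.span {p1, p2}"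
  shows "vec.span {p1, p2} = vec.span {u, w}"
proof
  have uw: "{u, w} \<subseteq> vec.span {p1, p2}" using assms by auto
  then show "vec.span {u, w} \<subseteq> vec.span {p1, p2}"
    by (rule vec.span_minimal) (rule vec.subspace_span)
  have "vec.dim (vec.span {p1, p2}) \<le> card {p1, p2}"
    using vec.dim_le_card'[of "{p1, p2}"] by (simp add: vec.dim_span)
  also have "\<dots> \<le> card {u, w}" using assms(2) by (simp add: card_insert_le_m1)
  finally show "vec.span {p1, p2} \<subseteq> vec.span {u, w}"
    using vec.card_ge_dim_independent[OF uw assms(1)] by blast
qed

section \<open>Traces and the Hermitian form\<close>

text \<open>The trace is taken on plain functions in the standard basis, so an equation between maps
  can be rewritten inside it directly.\<close>

definition endo_trace :: "(cvec \<Rightarrow> cvec) \<Rightarrow> complex" where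
  "endo_trace f = (\<Sum>i\<in>UNIV. f (axis i 1) $ i)"

locale hermitian =
  fixes h :: cform
  assumes hermitian: "hermitian_form h"
begin

lemma h_add_left: "h (x + y) z = h x z + h y z"
  and h_scale_left: "h (k *s x) y = k * h x y"
  and h_cnj: "cnj (h x y) = h y x"
  using hermitian unfolding hermitian_form_def by metis+

lemma h_add_right: "h x (y + z) = h x y + h x z"
  by (metis complex_cnj_add h_add_left h_cnj)

lemma h_scale_right: "h x (k *s y) = cnj k * h x y"
  by (metis complex_cnj_mult h_scale_left h_cnj)

lemma h_diff_left: "h (x - y) z = h x z - h y z"
  using h_add_left[of "x - y" y z] by simp

lemmas h_simps = h_add_left h_add_right h_scale_left h_scale_right h_diff_left

lemma h_zero_left: "h 0 y = 0"
  using h_scale_left[of 0 0 y] by simp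

lemma h_self_real: "h x x = complex_of_real (Re (h x x))"
  by (metis Reals_cnj_iff h_cnj of_real_Re)

lemma sig_eq_0_iff: "sig h x = 0 \<longleftrightarrow> h x x = 0"
  by (metis Re_complex_of_real h_self_real of_real_0 sgn_eq_0_iff sig_def)

lemma linear_h: "Vector_Spaces.linear (*s) (*) (\<lambda>x. h x a)"
  by unfold_locales (auto simp: h_simps vector_smult_assoc algebra_simps)

text \<open>Expanding \<open>b\<close> in the standard basis and using linearity of \<open>h\<close>
  in the first argument gives a value free of coordinates, although the basis need not be
  orthonormal for \<open>h\<close>.\<close>

lemma endo_trace_rank_one: "endo_trace (\<lambda>x. h x a *s b) = h b a"
proof -
  interpret l: Vector_Spaces.linear "(*s)" "(*)" "\<lambda>x::cvec. h x a" by (rule linear_h)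
  have "h b a = h (\<Sum>i\<in>UNIV. b $ i *s axis i 1) a"
    by (simp add: basis_expansion)
  also have "\<dots> = (\<Sum>i\<in>UNIV. b $ i * h (axis i 1) a)"
    by (subst l.sum) (simp add: h_simps)
  finally show ?thesis by (simp add: endo_trace_def mult.commute)
qed

section \<open>The isometries \<open>R_iso\<close> and their products\<close>

definition refl_coeff :: "complex \<Rightarrow> cvec \<Rightarrow> complex" where
  "refl_coeff \<alpha> p = (\<alpha> powi (-2) - \<alpha>) / h p p"

lemma R_iso_eq: "R_iso h \<alpha> p x = (refl_coeff \<alpha> p * h x p) *s p + \<alpha> *s x"
  by (simp add: R_iso_def refl_coeff_def)

text \<open>The factor \<open>k * cnj k\<close> cancels against \<open>h p p\<close>. Thus
  representatives of the \<open>q\<close>'s may be rescaled without changing the product.\<close>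

lemma R_iso_smult:
  assumes "k \<noteq> 0"
  shows "R_iso h \<alpha> (k *s p) = R_iso h \<alpha> p"
  using assms by (simp add: R_iso_def h_simps fun_eq_iff vec_eq_iff)

lemma R_iso_add: "R_iso h \<alpha> p (x + y) = R_iso h \<alpha> p x + R_iso h \<alpha> p y"
  and R_iso_scale: "R_iso h \<alpha> p (k *s x) = k *s R_iso h \<alpha> p x"
  by (simp_all add: R_iso_eq h_simps vec_eq_iff algebra_simps)

text \<open>This is where the exclusion of cube roots of unity enters: at such a root the rank one
  part of \<open>R_iso\<close> vanishes and \<open>p\<close> could not be recovered.\<close>

lemma reflection_scalar_nonzero:
  assumes "cmod \<alpha> = 1" "\<alpha> ^ 3 \<noteq> 1"
  shows "\<alpha> powi (-2) - \<alpha> \<noteq> 0"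
proof
  assume "\<alpha> powi (-2) - \<alpha> = 0"
  moreover have "\<alpha> \<noteq> 0" using assms by auto
  ultimately have "\<alpha> ^ 3 = 1"
    by (simp add: power_int_minus field_simps power2_eq_square power3_eq_cube)
  then show False using assms by simp
qed

text \<open>The eigenvalues \<open>\<alpha> powi (-2)\<close> on \<open>p\<close> and
  \<open>\<alpha>\<close> on its orthogonal complement are unimodular. In the expansion the extra
  term has the factor \<open>b * cnj b - \<alpha> * cnj \<alpha>\<close>, which is 0.\<close>

lemma R_iso_isometry:
  assumes "cmod \<alpha> = 1" "h p p \<noteq> 0"
  shows "h (R_iso h \<alpha> p x) (R_iso h \<alpha> p y) = h x y"
proof -
  define b where "b = \<alpha> powi (-2)"
  have "cmod b = 1" using assms(1) by (simp add: b_def norm_power_int)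
  then have a: "\<alpha> * cnj \<alpha> = 1" and b: "b * cnj b = 1"
    using assms(1) by (simp_all flip: complex_norm_square)
  have r: "cnj (h p p) = h p p" by (simp add: h_cnj)
  have "h (R_iso h \<alpha> p x) (R_iso h \<alpha> p y) =
      ((b - \<alpha>) * (cnj b - cnj \<alpha>) + (b - \<alpha>) * cnj \<alpha> + (cnj b - cnj \<alpha>) * \<alpha>) * (h x p * h p y / h p p)
      + \<alpha> * cnj \<alpha> * h x y"
    using assms(2) by (simp add: R_iso_def b_def[symmetric] h_simps h_cnj field_simps)
  also have "\<dots> = (b * cnj b - \<alpha> * cnj \<alpha>) * (h x p * h p y / h p p) + \<alpha> * cnj \<alpha> * h x y"
    by (simp add: algebra_simps)
  finally show ?thesis using a b by simp
qed

text \<open>Separates the scalar part from a part with image in the span of \<open>p1, p2\<close>,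
  which serves both the trace computation and the recovery of the line.\<close>

lemma R_product_eq:
  "R_iso h \<alpha>2 p2 (R_iso h \<alpha>1 p1 x) = (\<alpha>1 * \<alpha>2) *s x
     + (\<alpha>2 * refl_coeff \<alpha>1 p1 * h x p1) *s p1
     + (\<alpha>1 * refl_coeff \<alpha>2 p2 * h x p2
        + refl_coeff \<alpha>1 p1 * refl_coeff \<alpha>2 p2 * h x p1 * h p1 p2) *s p2"
  by (simp add: R_iso_eq h_simps vec_eq_iff algebra_simps)

text \<open>The product is a scalar map plus three rank one maps. Only the last summand depends on
  the points, through an invariant of the projective pair.\<close>

lemma endo_trace_R_product:
  assumes "h p1 p1 \<noteq> 0" "h p2 p2 \<noteq> 0"
  shows "endo_trace (R_iso h \<alpha>2 p2 \<circ> R_iso h \<alpha>1 p1) = 3 * \<alpha>1 * \<alpha>2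
     + \<alpha>2 * (\<alpha>1 powi (-2) - \<alpha>1) + \<alpha>1 * (\<alpha>2 powi (-2) - \<alpha>2)
     + (\<alpha>1 powi (-2) - \<alpha>1) * (\<alpha>2 powi (-2) - \<alpha>2) * (h p1 p2 * h p2 p1 / (h p1 p1 * h p2 p2))"
proof -
  let ?r1 = "refl_coeff \<alpha>1 p1" and ?r2 = "refl_coeff \<alpha>2 p2"
  have t: "endo_trace (\<lambda>x. h x a *s b) = (\<Sum>i\<in>UNIV. h (axis i 1) a * b $ i)" for a b
    by (simp add: endo_trace_def)
  have "endo_trace (R_iso h \<alpha>2 p2 \<circ> R_iso h \<alpha>1 p1) =
      3 * \<alpha>1 * \<alpha>2 + \<alpha>2 * ?r1 * endo_trace (\<lambda>x. h x p1 *s p1)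
      + \<alpha>1 * ?r2 * endo_trace (\<lambda>x. h x p2 *s p2)
      + ?r1 * ?r2 * h p1 p2 * endo_trace (\<lambda>x. h x p1 *s p2)"
    unfolding t by (simp add: endo_trace_def R_product_eq axis_def sum_3 algebra_simps)
  moreover have "?r1 * h p1 p1 = \<alpha>1 powi (-2) - \<alpha>1" "?r2 * h p2 p2 = \<alpha>2 powi (-2) - \<alpha>2"
    and "?r1 * ?r2 * h p1 p2 * h p2 p1 = (\<alpha>1 powi (-2) - \<alpha>1) * (\<alpha>2 powi (-2) - \<alpha>2)
      * (h p1 p2 * h p2 p1 / (h p1 p1 * h p2 p2))"
    using assms by (simp_all add: refl_coeff_def)
  ultimately show ?thesis by (simp only: endo_trace_rank_one mult.assoc)
qed

section \<open>Recovering the line and the Gram matrix from the product\<close>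

definition gram :: "cvec \<Rightarrow> cvec \<Rightarrow> complex" where
  "gram p1 p2 = h p1 p1 * h p2 p2 - h p1 p2 * h p2 p1"

text \<open>The vector \<open>w\<close> is orthogonal to \<open>p2\<close> and pairs with
  \<open>p1\<close> to the Gram determinant, so a vanishing determinant would put \<open>w\<close>
  in the radical of the line.\<close>

lemma gram_nonzero:
  assumes "noneuclidean h (cline p1 p2)" "vec.independent {p1, p2}" "p1 \<noteq> p2" "h p2 p2 \<noteq> 0"
  shows "gram p1 p2 \<noteq> 0"
proof
  assume g: "gram p1 p2 = 0"
  define w where "w = h p2 p2 *s p1 + (- h p1 p2) *s p2"
  have "w \<in> cline p1 p2" unfolding cline_def mem_span_pair_iff w_def by blast
  moreover have "h w u = 0" if u_in: "u \<in> cline p1 p2" for u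
  proof -
    obtain a b where u: "u = a *s p1 + b *s p2"
      using u_in unfolding cline_def mem_span_pair_iff by blast
    have "h w u = cnj a * gram p1 p2"
      by (simp add: w_def u h_simps gram_def algebra_simps)
    then show ?thesis using g by simp
  qed
  ultimately have "w = 0" using assms(1) by (auto simp: noneuclidean_def)
  then have "h p2 p2 = 0"
    using independent_pair_zero[OF assms(2,3)] unfolding w_def by blast
  then show False using assms(4) by simp
qed

text \<open>Subtracting the common scalar part shows that the image for the \<open>q\<close>'s lies
  in the line of the \<open>p\<close>'s. Suitable arguments then isolate \<open>q2\<close> and
  \<open>q1\<close> in that image.\<close>

lemma range_R_product:
  assumes "R_iso h \<alpha>2 p2 \<circ> R_iso h \<alpha>1 p1 = R_iso h \<alpha>2 q2 \<circ> R_iso h \<alpha>1 q1"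
    and "gram q1 q2 \<noteq> 0" "\<alpha>1 \<noteq> 0" "\<alpha>2 \<noteq> 0"
    and "refl_coeff \<alpha>1 q1 \<noteq> 0" "refl_coeff \<alpha>2 q2 \<noteq> 0"
  shows "q1 \<in> cline p1 p2" "q2 \<in> cline p1 p2"
proof -
  let ?L = "cline p1 p2"
  have sm: "k *s z \<in> ?L" if "z \<in> ?L" for k z
    using that by (simp add: cline_def vec.span_scale)
  have sm': "z \<in> ?L" if "k *s z \<in> ?L" "k \<noteq> 0" for k z
    using sm[OF that(1), of "inverse k"] that(2) by (simp add: vector_smult_assoc)
  define A where "A x = \<alpha>2 * refl_coeff \<alpha>1 q1 * h x q1" for x
  define C where "C x = \<alpha>1 * refl_coeff \<alpha>2 q2 * h x q2
        + refl_coeff \<alpha>1 q1 * refl_coeff \<alpha>2 q2 * h x q1 * h q1 q2" for x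
  have im: "A x *s q1 + C x *s q2 \<in> ?L" for x
  proof -
    have "R_iso h \<alpha>2 q2 (R_iso h \<alpha>1 q1 x) = R_iso h \<alpha>2 p2 (R_iso h \<alpha>1 p1 x)"
      using assms(1) by (metis comp_apply)
    then have "A x *s q1 + C x *s q2 = (\<alpha>2 * refl_coeff \<alpha>1 p1 * h x p1) *s p1
     + (\<alpha>1 * refl_coeff \<alpha>2 p2 * h x p2
        + refl_coeff \<alpha>1 p1 * refl_coeff \<alpha>2 p2 * h x p1 * h p1 p2) *s p2"
      unfolding R_product_eq A_def C_def by (simp only: add.assoc add_left_cancel)
    then show ?thesis unfolding cline_def mem_span_pair_iff by blast
  qed
  \<comment> \<open>Being orthogonal to \<open>q1\<close>, this \<open>x\<close> kills
    \<open>A\<close>; its pairing with \<open>q2\<close> is the Gram determinant, so only a nonzero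
    multiple of \<open>q2\<close> survives.\<close>
  define x where "x = h q1 q1 *s q2 + (- h q2 q1) *s q1"
  have "h x q1 = 0" by (simp add: x_def h_simps)
  moreover have "h x q2 = gram q1 q2" by (simp add: x_def h_simps gram_def algebra_simps)
  ultimately have "A x = 0" "C x \<noteq> 0" using assms by (auto simp: A_def C_def)
  then show q2: "q2 \<in> ?L" using im[of x] sm'[of "C x" q2] by simp
  \<comment> \<open>Here \<open>y\<close> is orthogonal to \<open>q2\<close>, yet the cross term of
    \<open>C y\<close> may survive; it is subtracted, \<open>q2\<close> being already known to lie
    in the line.\<close>
  define y where "y = h q2 q2 *s q1 + (- h q1 q2) *s q2"
  have "h y q1 = gram q1 q2" by (simp add: y_def h_simps gram_def algebra_simps)
  then have "A y \<noteq> 0" using assms by (auto simp: A_def)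
  moreover have "A y *s q1 \<in> ?L"
    using vec.span_diff[OF im[of y, unfolded cline_def] sm[OF q2, of "C y", unfolded cline_def]]
    by (simp add: cline_def)
  ultimately show "q1 \<in> ?L" using sm' by blast
qed

lemma rescale_self:
  assumes "sig h p = sig h q" "sig h q \<noteq> 0"
  shows "\<exists>k::real. k > 0 \<and> h (complex_of_real k *s q) (complex_of_real k *s q) = h p p"
proof -
  define k where "k = sqrt (Re (h p p) / Re (h q q))"
  have pos: "Re (h p p) / Re (h q q) > 0"
    using assms by (auto simp: sig_def sgn_if zero_less_divide_iff split: if_splits)
  then have "Re (h q q) \<noteq> 0" by auto
  then have "k^2 * Re (h q q) = Re (h p p)"
    using pos unfolding k_def by (simp add: less_imp_le)
  then have "complex_of_real k * (complex_of_real k * h q q) = h p p"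
    by (subst h_self_real[of q], subst h_self_real[of p])
      (simp add: power2_eq_square mult.assoc flip: of_real_mult)
  then show ?thesis using pos by (intro exI[of _ k]) (simp add: k_def h_simps)
qed

text \<open>Positive factors match the self-pairings, as the signs agree. The invariant then forces
  the mixed pairings to have equal modulus, and a unimodular factor on \<open>q2\<close> corrects
  the phase.\<close>

lemma rescale_pair:
  assumes "sig h p1 = sig h q1" "sig h p2 = sig h q2" "sig h q1 \<noteq> 0" "sig h q2 \<noteq> 0"
    and "h p1 p2 \<noteq> 0"
    and "h p1 p2 * h p2 p1 / (h p1 p1 * h p2 p2) = h q1 q2 * h q2 q1 / (h q1 q1 * h q2 q2)"
  shows "\<exists>k1 k2. k1 \<noteq> 0 \<and> k2 \<noteq> 0 \<and> h (k1 *s q1) (k1 *s q1) = h p1 p1 \<and>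
     h (k2 *s q2) (k2 *s q2) = h p2 p2 \<and> h (k1 *s q1) (k2 *s q2) = h p1 p2"
proof -
  obtain k1 k2 :: real where k: "k1 > 0" "k2 > 0"
    and h1: "h (complex_of_real k1 *s q1) (complex_of_real k1 *s q1) = h p1 p1"
    and h2: "h (complex_of_real k2 *s q2) (complex_of_real k2 *s q2) = h p2 p2"
    using rescale_self[OF assms(1,3)] rescale_self[OF assms(2,4)] by blast
  define m where "m = h (complex_of_real k1 *s q1) (complex_of_real k2 *s q2)"
  have nz: "h q1 q1 \<noteq> 0" "h q2 q2 \<noteq> 0" "h p1 p1 \<noteq> 0" "h p2 p2 \<noteq> 0"
    using assms by (metis sig_eq_0_iff)+
  have "h p1 p2 * h p2 p1 = m * cnj m"
  proof -
    have "h p1 p2 * h p2 p1 = h q1 q2 * h q2 q1 / (h q1 q1 * h q2 q2) * (h p1 p1 * h p2 p2)"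
      using assms(6) nz by (simp add: field_simps)
    also have "\<dots> = m * cnj m"
      using nz by (simp add: h1[symmetric] h2[symmetric] m_def h_simps h_cnj)
    finally show ?thesis .
  qed
  then have mod: "h p1 p2 * cnj (h p1 p2) = m * cnj m" by (simp add: h_cnj)
  then have m0: "m \<noteq> 0" using assms(5) by auto
  \<comment> \<open>The conjugate appears because \<open>h\<close> is conjugate linear in its second
    argument.\<close>
  define e where "e = cnj (h p1 p2 / m)"
  have e: "e * cnj e = 1" using mod m0 by (simp add: e_def field_simps)
  show ?thesis
  proof (intro exI conjI)
    show "complex_of_real k1 \<noteq> 0" using k by simp
    show "e * complex_of_real k2 \<noteq> 0" using k e by auto
    show "h (complex_of_real k1 *s q1) (complex_of_real k1 *s q1) = h p1 p1" by (rule h1)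
    have "h ((e * complex_of_real k2) *s q2) ((e * complex_of_real k2) *s q2) =
        e * cnj e * h (complex_of_real k2 *s q2) (complex_of_real k2 *s q2)"
      by (simp add: h_simps)
    then show "h ((e * complex_of_real k2) *s q2) ((e * complex_of_real k2) *s q2) = h p2 p2"
      using e h2 by simp
    have "h (complex_of_real k1 *s q1) ((e * complex_of_real k2) *s q2) = cnj e * m"
      by (simp add: m_def h_simps)
    then show "h (complex_of_real k1 *s q1) ((e * complex_of_real k2) *s q2) = h p1 p2"
      using m0 by (simp add: e_def)
  qed
qed

section \<open>Nonscalarity of the product and isometries of the line\<close>

text \<open>The first factor only scales \<open>p1\<close>, while the second adds a nonzero multiple
  of \<open>p2\<close>. Hence the product is not scalar on the line.\<close>

lemma R_product_not_eigenvector: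
  assumes "vec.independent {p1, p2}" "p1 \<noteq> p2" "h p1 p1 \<noteq> 0" "h p1 p2 \<noteq> 0"
    and "refl_coeff \<alpha>2 p2 \<noteq> 0" "\<alpha>1 \<noteq> 0"
  shows "R_iso h \<alpha>2 p2 (R_iso h \<alpha>1 p1 p1) \<noteq> \<nu> *s p1"
proof
  assume eq: "R_iso h \<alpha>2 p2 (R_iso h \<alpha>1 p1 p1) = \<nu> *s p1"
  have "R_iso h \<alpha>1 p1 p1 = \<alpha>1 powi (-2) *s p1"
    using assms(3) by (simp add: R_iso_def vec_eq_iff algebra_simps)
  then have "R_iso h \<alpha>2 p2 (R_iso h \<alpha>1 p1 p1) = \<alpha>1 powi (-2) *s R_iso h \<alpha>2 p2 p1"
    by (simp add: R_iso_scale)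
  also have "\<dots> = (\<alpha>1 powi (-2) * \<alpha>2) *s p1 + (refl_coeff \<alpha>2 p2 * \<alpha>1 powi (-2) * h p1 p2) *s p2"
    by (simp add: R_iso_eq vec_eq_iff algebra_simps)
  finally have "(\<alpha>1 powi (-2) * \<alpha>2) *s p1 + (refl_coeff \<alpha>2 p2 * \<alpha>1 powi (-2) * h p1 p2) *s p2
      = \<nu> *s p1 + 0 *s p2"
    using eq by simp
  from independent_pair_eq[OF assms(1,2) this] show False
    using assms(4-6) by simp
qed

lemma isotropic_pair_not_orthogonal:
  assumes "noneuclidean h (vec.span {u, w})" "u \<noteq> 0" "h u u = 0"
  shows "h u w \<noteq> 0"
proof
  assume "h u w = 0"
  then have "\<forall>z\<in>vec.span {u, w}. h u z = 0"
    using assms(3) by (auto simp: mem_span_pair_iff h_simps)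
  moreover have "u \<in> vec.span {u, w}" by (simp add: vec.span_base)
  ultimately show False using assms by (auto simp: noneuclidean_def)
qed

text \<open>By sesquilinearity, equal Gram matrices suffice. The map is defined on the whole space,
  but its values off the span are arbitrary.\<close>

lemma isometry_extension:
  assumes "vec.independent {p1, p2}" "p1 \<noteq> p2"
    and "h q1 q1 = h p1 p1" "h q2 q2 = h p2 p2" "h q1 q2 = h p1 p2"
  shows "\<exists>g. Vector_Spaces.linear (*s) (*s) g \<and> g p1 = q1 \<and> g p2 = q2 \<and>
    (\<forall>x\<in>vec.span {p1, p2}. \<forall>y\<in>vec.span {p1, p2}. h (g x) (g y) = h x y)"
proof -
  obtain g where g: "Vector_Spaces.linear (*s) (*s) g"
    and gp: "\<forall>v\<in>{p1, p2}. g v = (if v = p1 then q1 else q2)"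
    using vec.linear_independent_extend[OF assms(1), of "\<lambda>v. if v = p1 then q1 else q2"] by blast
  interpret g: Vector_Spaces.linear "(*s)" "(*s)" g by (rule g)
  have gp1: "g p1 = q1" and gp2: "g p2 = q2" using gp assms(2) by auto
  have "h q2 q1 = h p2 p1" using assms(5) by (metis h_cnj)
  then have "h (g x) (g y) = h x y" if "x \<in> vec.span {p1, p2}" "y \<in> vec.span {p1, p2}" for x y
    using that assms(3-5)
    by (auto simp: mem_span_pair_iff g.add g.scale gp1 gp2 h_simps)
  then show ?thesis using g gp1 gp2 by blast
qed

lemma R_iso_in_span:
  assumes "p \<in> vec.span S" "x \<in> vec.span S"
  shows "R_iso h \<alpha> p x \<in> vec.span S"
  using assms by (simp add: R_iso_eq vec.span_add vec.span_scale)

text \<open>Only these two values of the form enter \<open>R_iso\<close>, so the lemma applies to a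
  \<open>g\<close> that is isometric merely on the line.\<close>

lemma R_iso_intertwine:
  assumes "Vector_Spaces.linear (*s) (*s) g"
    and "h (g p) (g p) = h p p" "h (g x) (g p) = h x p"
  shows "R_iso h \<alpha> (g p) (g x) = g (R_iso h \<alpha> p x)"
proof -
  interpret g: Vector_Spaces.linear "(*s)" "(*s)" g by (rule assms(1))
  show ?thesis using assms(2,3) by (simp add: R_iso_def g.add g.scale)
qed

end

section \<open>Centralizers in the elliptic, loxodromic and parabolic cases\<close>

text \<open>Commutation makes \<open>g u\<close> a \<open>\<nu>\<close>-eigenvector, and within the
  plane that eigenspace is spanned by \<open>u\<close>.\<close>

lemma commuting_diagonal:
  fixes R g :: "cvec \<Rightarrow> cvec"
  assumes "vec.independent {u, w}" "u \<noteq> w"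
    and "Vector_Spaces.linear (*s) (*s) R" "Vector_Spaces.linear (*s) (*s) g"
    and "R u = \<nu> *s u" "R w = \<mu> *s w" "\<nu> \<noteq> \<mu>"
    and "g u \<in> vec.span {u, w}" "R (g u) = g (R u)"
  shows "\<exists>a. g u = a *s u"
proof -
  interpret R: Vector_Spaces.linear "(*s)" "(*s)" R by (rule assms(3))
  interpret g: Vector_Spaces.linear "(*s)" "(*s)" g by (rule assms(4))
  obtain a b where g: "g u = a *s u + b *s w"
    using assms(8) by (auto simp: mem_span_pair_iff)
  have "(a * \<nu>) *s u + (b * \<mu>) *s w = (a * \<nu>) *s u + (b * \<nu>) *s w"
    using assms(9) by (simp add: assms(5,6) g R.add R.scale g.scale vec_eq_iff algebra_simps)
  then have "b * \<mu> = b * \<nu>" using independent_pair_eq[OF assms(1,2)] by blast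
  then have "b = 0" using assms(7) by simp
  then show ?thesis using g by (intro exI[of _ a]) simp
qed

text \<open>Half the difference of the arguments gives the parameter; half their sum gives
  \<open>\<kappa>\<close>, which disappears projectively.\<close>

lemma unit_pair_eq_cis:
  assumes "cmod a = 1" "cmod b = 1"
  shows "\<exists>s \<kappa>. \<kappa> \<noteq> 0 \<and> a = \<kappa> * cis (s / 2) \<and> b = \<kappa> * cis (- s / 2)"
proof (intro exI conjI)
  let ?s = "Arg a - Arg b" and ?k = "cis ((Arg a + Arg b) / 2)"
  show "?k \<noteq> 0" by simp
  have "a = cis (Arg a)" "b = cis (Arg b)"
    using assms rcis_cmod_Arg[of a] rcis_cmod_Arg[of b] by (simp_all add: rcis_def)
  moreover have "?k * cis (?s / 2) = cis (Arg a)" "?k * cis (- ?s / 2) = cis (Arg b)"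
    by (simp_all add: cis_mult field_simps)
  ultimately show "a = ?k * cis (?s / 2)" "b = ?k * cis (- ?s / 2)" by simp_all
qed

text \<open>The hypothesis says that \<open>a\<close> and \<open>b\<close> have equal phase and
  reciprocal moduli: \<open>\<kappa>\<close> is the phase and \<open>s\<close> the logarithm of
  \<open>cmod a\<close>.\<close>

lemma inverse_pair_eq_exp:
  assumes "a * cnj b = 1"
  shows "\<exists>s \<kappa>. \<kappa> \<noteq> 0 \<and> a = \<kappa> * complex_of_real (exp s) \<and> b = \<kappa> * complex_of_real (exp (- s))"
proof (intro exI conjI)
  let ?s = "ln (cmod a)"
  have a: "a \<noteq> 0" using assms by auto
  then show "sgn a \<noteq> 0" by (simp add: sgn_zero_iff)
  show 1: "a = sgn a * complex_of_real (exp ?s)"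
    using a by (simp add: sgn_eq)
  have "cnj a * b = 1" using assms by (metis complex_cnj_cnj complex_cnj_mult complex_cnj_one)
  moreover have "cnj a * (sgn a * complex_of_real (exp (- ?s))) = 1"
    using a complex_norm_square[of a]
    by (simp add: sgn_eq exp_minus field_simps power2_eq_square)
  moreover have "cnj a \<noteq> 0" using a by simp
  ultimately show "b = sgn a * complex_of_real (exp (- ?s))"
    by (metis mult_left_cancel)
qed

context hermitian
begin

lemma elliptic_centralizer:
  assumes "h u u \<noteq> 0" "h w w \<noteq> 0" "g u = a *s u" "g w = b *s w"
    and "h (g u) (g u) = h u u" "h (g w) (g w) = h w w"
  shows "\<exists>s \<kappa>. \<kappa> \<noteq> 0 \<and> g u = \<kappa> *s (cis (s / 2) *s u) \<and> g w = \<kappa> *s (cis (- s / 2) *s w)"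
proof -
  have "a * cnj a = 1" "b * cnj b = 1" using assms by (auto simp: h_simps mult.commute)
  then have "cmod a = 1" "cmod b = 1"
    by (metis abs_norm_cancel abs_square_eq_1 complex_norm_square of_real_eq_1_iff)+
  from unit_pair_eq_cis[OF this] show ?thesis
    using assms(3,4) by (metis vector_smult_assoc)
qed

lemma loxodromic_centralizer:
  assumes "h u w \<noteq> 0" "g u = a *s u" "g w = b *s w" "h (g u) (g w) = h u w"
  shows "\<exists>s \<kappa>. \<kappa> \<noteq> 0 \<and> g u = \<kappa> *s (complex_of_real (exp s) *s u)
    \<and> g w = \<kappa> *s (complex_of_real (exp (- s)) *s w)"
proof -
  have "a * cnj b = 1" using assms by (auto simp: h_simps mult.commute)
  from inverse_pair_eq_exp[OF this] show ?thesis
    using assms(2,3) by (metis vector_smult_assoc)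
qed

text \<open>If the eigenvalues of \<open>R\<close> differed, then \<open>\<bar>\<mu>\<bar> \<noteq> 1\<close> and the second eigenvector would be
  isotropic, giving a second isotropic fixed point.\<close>

lemma parabolic_jordan_block:
  assumes "vec.independent {u, w}" "u \<noteq> w" "Vector_Spaces.linear (*s) (*s) R"
    and "h u u = 0" "h w w = 0" "h u w \<noteq> 0"
    and "R u = \<nu> *s u" "R w = \<beta> *s u + \<mu> *s w"
    and iso: "\<And>x y. h (R x) (R y) = h x y"
    and unique: "\<And>v. v \<noteq> 0 \<Longrightarrow> h v v = 0 \<Longrightarrow> \<exists>k. R v = k *s v \<Longrightarrow> \<exists>k. v = k *s u"
  shows "\<mu> = \<nu>"
proof (rule ccontr)
  assume ne: "\<mu> \<noteq> \<nu>"
  interpret R: Vector_Spaces.linear "(*s)" "(*s)" R by (rule assms(3))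
  have lm: "\<nu> * cnj \<mu> = 1"
    using iso[of u w] assms(4,6) by (simp add: assms(7,8) h_simps mult.commute)
  \<comment> \<open>The \<open>\<mu>\<close>-eigenvector of the upper triangular matrix of
    \<open>R\<close> in the basis \<open>u, w\<close>.\<close>
  define v where "v = \<beta> *s u + (\<mu> - \<nu>) *s w"
  have Rv: "R v = \<mu> *s v"
    by (simp add: v_def R.add R.scale R.diff assms(7,8) vec_eq_iff algebra_simps)
  have "\<mu> * cnj \<mu> \<noteq> 1"
  proof
    assume "\<mu> * cnj \<mu> = 1"
    then have "(\<mu> - \<nu>) * cnj \<mu> = 0" using lm by (simp add: algebra_simps)
    then show False using ne lm by auto
  qed
  moreover have "\<mu> * cnj \<mu> * h v v = h v v"
    using iso[of v v] by (simp add: Rv h_simps mult.commute)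
  ultimately have "h v v = 0" by (metis mult_cancel_right1)
  moreover have v0: "v \<noteq> 0"
    using independent_pair_zero[OF assms(1,2), of \<beta> "\<mu> - \<nu>"] ne by (auto simp: v_def)
  ultimately obtain k where "v = k *s u" using unique Rv by blast
  then have "\<beta> *s u + (\<mu> - \<nu>) *s w = k *s u + 0 *s w" by (simp add: v_def)
  from independent_pair_eq[OF assms(1,2) this] show False using ne by simp
qed

text \<open>Commuting with a nontrivial Jordan block forces an upper triangular matrix with equal
  diagonal entries \<open>a\<close>. Isometry then makes \<open>a\<close> unimodular and the
  off-diagonal entry, divided by \<open>a\<close>, purely imaginary.\<close>

lemma parabolic_centralizer:
  assumes "vec.independent {u, w}" "u \<noteq> w"
    and "Vector_Spaces.linear (*s) (*s) R" "Vector_Spaces.linear (*s) (*s) g"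
    and "h w w = 0" "h u w \<noteq> 0" "h u w \<in> \<real>" "h u u = 0"
    and "R u = \<nu> *s u" "R w = \<beta> *s u + \<nu> *s w" "\<beta> \<noteq> 0"
    and "g u \<in> vec.span {u, w}" "g w \<in> vec.span {u, w}"
    and "R (g u) = g (R u)" "R (g w) = g (R w)"
    and "h (g u) (g w) = h u w" "h (g w) (g w) = h w w"
  shows "\<exists>s \<kappa>. \<kappa> \<noteq> 0 \<and> g u = \<kappa> *s u \<and> g w = \<kappa> *s ((\<i> * complex_of_real s) *s u + w)"
proof -
  interpret R: Vector_Spaces.linear "(*s)" "(*s)" R by (rule assms(3))
  interpret g: Vector_Spaces.linear "(*s)" "(*s)" g by (rule assms(4))
  obtain a b where gu: "g u = a *s u + b *s w"
    using assms(12) by (auto simp: mem_span_pair_iff)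
  obtain c d where gw: "g w = c *s u + d *s w"
    using assms(13) by (auto simp: mem_span_pair_iff)
  have "(a * \<nu> + b * \<beta>) *s u + (b * \<nu>) *s w = (\<nu> * a) *s u + (\<nu> * b) *s w"
    using assms(14) by (simp add: assms(9,10) gu R.add R.scale g.scale vec_eq_iff algebra_simps)
  from independent_pair_eq[OF assms(1,2) this] have b: "b = 0" using assms(11) by auto
  have "(c * \<nu> + d * \<beta>) *s u + (d * \<nu>) *s w = (\<beta> * a + \<nu> * c) *s u + (\<nu> * d) *s w"
    using assms(15)
    by (simp add: assms(9,10) gu gw b R.add R.scale g.add g.scale vec_eq_iff algebra_simps)
  from independent_pair_eq[OF assms(1,2) this] have d: "d = a"
    using assms(11) by (auto simp: algebra_simps)
  have a: "a * cnj a = 1"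
    using assms(16,6,8) by (simp add: gu gw b d h_simps mult.commute)
  then have a0: "a \<noteq> 0" by auto
  \<comment> \<open>Since \<open>h u w\<close> is real, isotropy of \<open>g w\<close> amounts to
    the vanishing of the real part of \<open>c * cnj a\<close>.\<close>
  have "h w u = h u w" using assms(7) by (metis Reals_cnj_iff h_cnj)
  then have "(c * cnj a + a * cnj c) * h u w = 0"
    using assms(17,5,8) by (simp add: gw d h_simps algebra_simps)
  then have "c * cnj a + cnj (c * cnj a) = 0" using assms(6) by (simp add: mult.commute)
  then have "2 * Re (c * cnj a) = 0" unfolding complex_add_cnj of_real_eq_0_iff .
  then have "Re (c * cnj a) = 0" by linarith
  then have "c * cnj a = \<i> * complex_of_real (Im (c * cnj a))" by (simp add: complex_eq_iff)
  then obtain s where s: "c * cnj a = \<i> * complex_of_real s" by blast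
  \<comment> \<open>As \<open>cnj a\<close> inverts \<open>a\<close>, factoring \<open>a\<close> out
    of \<open>g w\<close> leaves the coefficient \<open>c * cnj a\<close>; so
    \<open>\<kappa>\<close> is \<open>a\<close>.\<close>
  have "c = a * (c * cnj a)" using a by (simp add: algebra_simps)
  then have "g w = a *s ((\<i> * complex_of_real s) *s u + w)"
    unfolding gw d s by (simp add: vec_eq_iff algebra_simps)
  then show ?thesis using a0 gu b by (intro exI[of _ s] exI[of _ a]) simp
qed

end

section \<open>Comparison of the isometry \<open>g\<close> with the bending subgroup\<close>

theorem theorem4p7:
  fixes h :: cform and p1 p2 q1 q2 :: cvec and \<alpha>1 \<alpha>2 :: complex
    and B :: "real \<Rightarrow> cvec \<Rightarrow> cvec"
  assumes "hermitian_form h" and "signature_ppm h"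
    and "sig h p1 \<noteq> 0" and "sig h p2 \<noteq> 0" and "proj p1 \<noteq> proj p2" and "h p1 p2 \<noteq> 0"
    and "sig h q1 \<noteq> 0" and "sig h q2 \<noteq> 0" and "proj q1 \<noteq> proj q2" and "h q1 q2 \<noteq> 0"
    and "cmod \<alpha>1 = 1" and "\<alpha>1 ^ 3 \<noteq> 1" and "cmod \<alpha>2 = 1" and "\<alpha>2 ^ 3 \<noteq> 1"
    and "noneuclidean h (cline p1 p2)"
    and "sig h p1 = sig h q1" and "sig h p2 = sig h q2"
    and "R_iso h \<alpha>2 p2 \<circ> R_iso h \<alpha>1 p1 = R_iso h \<alpha>2 q2 \<circ> R_iso h \<alpha>1 q1"
    and "bending_subgroup h \<alpha>1 p1 \<alpha>2 p2 B"
  shows "\<exists>s. proj (B s p1) = proj q1 \<and> proj (B s p2) = proj q2"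
proof -
  interpret hermitian h by unfold_locales (rule assms(1))
  define R where "R = R_iso h \<alpha>2 p2 \<circ> R_iso h \<alpha>1 p1"
  have R_q: "R = R_iso h \<alpha>2 q2 \<circ> R_iso h \<alpha>1 q1" using assms(18) by (simp add: R_def)
  have nz: "h p1 p1 \<noteq> 0" "h p2 p2 \<noteq> 0" "h q1 q1 \<noteq> 0" "h q2 q2 \<noteq> 0"
    using assms(3,4,7,8) by (auto simp: sig_eq_0_iff)
  then have "p1 \<noteq> 0" "p2 \<noteq> 0" by (auto simp: h_zero_left)
  then have ind: "vec.independent {p1, p2}" "p1 \<noteq> p2"
    using independent_pairI assms(5) by blast+
  have \<alpha>: "\<alpha>1 \<noteq> 0" "\<alpha>2 \<noteq> 0" using assms(11,13) by auto
  note k = reflection_scalar_nonzero[OF assms(11,12)] reflection_scalar_nonzero[OF assms(13,14)]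
  have coeff: "refl_coeff \<alpha>2 p2 \<noteq> 0" "refl_coeff \<alpha>1 q1 \<noteq> 0" "refl_coeff \<alpha>2 q2 \<noteq> 0"
    using k nz by (auto simp: refl_coeff_def)
  \<comment> \<open>The coefficient of the point-dependent term of the trace; cancelling it yields
    \<open>tance\<close>.\<close>
  let ?K = "(\<alpha>1 powi (-2) - \<alpha>1) * (\<alpha>2 powi (-2) - \<alpha>2)"
  have "?K * (h p1 p2 * h p2 p1 / (h p1 p1 * h p2 p2))
      = ?K * (h q1 q2 * h q2 q1 / (h q1 q1 * h q2 q2))"
    using endo_trace_R_product[OF nz(1,2), of \<alpha>2 \<alpha>1] endo_trace_R_product[OF nz(3,4), of \<alpha>2 \<alpha>1]
    unfolding assms(18) by (simp only: add_left_cancel)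
  moreover have "?K \<noteq> 0" using k by simp
  ultimately have tance:
    "h p1 p2 * h p2 p1 / (h p1 p1 * h p2 p2) = h q1 q2 * h q2 q1 / (h q1 q1 * h q2 q2)"
    using mult_left_cancel by blast
  have "gram p1 p2 \<noteq> 0" using gram_nonzero[OF assms(15) ind nz(2)] .
  \<comment> \<open>Divided by the product of the self-pairings, the Gram determinant is 1 minus the
    invariant in \<open>tance\<close>, so nondegeneracy passes to the \<open>q\<close>'s.\<close>
  then have "gram q1 q2 \<noteq> 0" using tance nz by (auto simp: gram_def field_simps)
  from range_R_product[OF assms(18) this \<alpha> coeff(2,3)]
  have q_in: "q1 \<in> cline p1 p2" "q2 \<in> cline p1 p2" .
  obtain k1 k2 where k12: "k1 \<noteq> 0" "k2 \<noteq> 0" "h (k1 *s q1) (k1 *s q1) = h p1 p1"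
     "h (k2 *s q2) (k2 *s q2) = h p2 p2" "h (k1 *s q1) (k2 *s q2) = h p1 p2"
    using rescale_pair[OF assms(16,17,7,8,6) tance] by blast
  obtain g where g: "Vector_Spaces.linear (*s) (*s) g" and gp: "g p1 = k1 *s q1" "g p2 = k2 *s q2"
    and g_iso: "\<And>x y. x \<in> cline p1 p2 \<Longrightarrow> y \<in> cline p1 p2 \<Longrightarrow> h (g x) (g y) = h x y"
    using isometry_extension[OF ind k12(3-5)] unfolding cline_def by blast
  interpret g: Vector_Spaces.linear "(*s)" "(*s)" g by (rule g)
  have p_in: "p1 \<in> cline p1 p2" "p2 \<in> cline p1 p2" by (auto simp: cline_def vec.span_base)
  have R_lin: "Vector_Spaces.linear (*s) (*s) R"
    by unfold_locales (simp_all add: R_def R_iso_add R_iso_scale)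
  have R_iso: "h (R x) (R y) = h x y" for x y
    using assms(11,13) nz by (simp add: R_def R_iso_isometry)
  have g_in: "g x \<in> cline p1 p2" if "x \<in> cline p1 p2" for x
    using that q_in unfolding cline_def
    by (subst (asm) mem_span_pair_iff) (auto simp: g.add g.scale gp vec.span_add vec.span_scale)
  \<comment> \<open>Conjugation by \<open>g\<close> turns the factors built on \<open>p1, p2\<close>
    into those built on the rescaled \<open>q1, q2\<close>, whose product is again
    \<open>R\<close>.\<close>
  have commute: "R (g x) = g (R x)" if "x \<in> cline p1 p2" for x
  proof -
    have 1: "R_iso h \<alpha>1 p1 x \<in> cline p1 p2"
      using R_iso_in_span that p_in unfolding cline_def by blast
    have "R (g x) = R_iso h \<alpha>2 (g p2) (R_iso h \<alpha>1 (g p1) (g x))"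
      using k12(1,2) by (simp add: R_q gp R_iso_smult)
    also have "\<dots> = R_iso h \<alpha>2 (g p2) (g (R_iso h \<alpha>1 p1 x))"
      using R_iso_intertwine[OF g] g_iso p_in that by metis
    also have "\<dots> = g (R x)"
      using R_iso_intertwine[OF g] g_iso p_in 1 by (simp add: R_def)
    finally show ?thesis .
  qed
  have span_eq: "cline p1 p2 = vec.span {u, w}"
    if "vec.independent {u, w}" "u \<noteq> w" "u \<in> cline p1 p2" "w \<in> cline p1 p2" for u w
    using span_pair_eq[OF that(1,2)] that(3,4) unfolding cline_def by blast
  have not_scalar: "\<nu> \<noteq> \<mu>"
    if uw: "vec.independent {u, w}" "u \<noteq> w" "u \<in> cline p1 p2" "w \<in> cline p1 p2"
      and e: "R u = \<nu> *s u" "R w = \<mu> *s w" for u w \<nu> \<mu>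
  proof
    assume eq: "\<nu> = \<mu>"
    interpret R: Vector_Spaces.linear "(*s)" "(*s)" R by (rule R_lin)
    obtain a b where "p1 = a *s u + b *s w"
      using p_in(1) span_eq[OF uw] by (auto simp: mem_span_pair_iff)
    then have "R p1 = \<nu> *s p1"
      by (simp add: R.add R.scale e eq vec.scale_right_distrib vector_smult_assoc mult.commute)
    then show False
      using R_product_not_eigenvector[OF ind nz(1) assms(6) coeff(1) \<alpha>(1)] by (simp add: R_def)
  qed
  have diagonal: "(\<exists>a. g u = a *s u) \<and> (\<exists>b. g w = b *s w)"
    if uw: "vec.independent {u, w}" "u \<noteq> w" "u \<in> cline p1 p2" "w \<in> cline p1 p2"
      and fixed: "fixed_point R u" "fixed_point R w" for u w
  proof -
    obtain \<nu> \<mu> where e: "R u = \<nu> *s u" "R w = \<mu> *s w"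
      using fixed by (auto simp: fixed_point_def)
    have ne: "\<nu> \<noteq> \<mu>" using not_scalar[OF uw e] .
    have "vec.independent {w, u}" using uw(1) by (simp add: insert_commute)
    then show ?thesis
      using commuting_diagonal[OF uw(1,2) R_lin g e ne]
        commuting_diagonal[OF _ not_sym[OF uw(2)] R_lin g e(2,1) not_sym[OF ne]]
        g_in commute uw(3,4) span_eq[OF uw]
      by (metis insert_commute)
  qed
  \<comment> \<open>Agreement up to one common factor on a basis of the line extends to
    \<open>p1, p2\<close>, and the factor is invisible projectively.\<close>
  have finish: ?thesis
    if uw: "vec.independent {u, w}" "u \<noteq> w" "u \<in> cline p1 p2" "w \<in> cline p1 p2"
      and \<kappa>: "\<kappa> \<noteq> 0" and B: "B s \<in> SU21 h" "g u = \<kappa> *s B s u" "g w = \<kappa> *s B s w"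
    for u w \<kappa> s
  proof -
    interpret B: Vector_Spaces.linear "(*s)" "(*s)" "B s" using B(1) by (simp add: SU21_def)
    have gB: "g x = \<kappa> *s B s x" if "x \<in> cline p1 p2" for x
      using that unfolding span_eq[OF uw] mem_span_pair_iff
      by (auto simp: g.add g.scale B.add B.scale B(2,3) vec.scale_right_distrib vector_smult_assoc
          mult.commute)
    have "proj (B s p1) = proj q1" "proj (B s p2) = proj q2"
      using gB p_in gp proj_smult \<kappa> k12(1,2) by metis+
    then show ?thesis by blast
  qed
  have nondeg: "h u w \<noteq> 0"
    if "vec.independent {u, w}" "u \<noteq> w" "u \<in> cline p1 p2" "w \<in> cline p1 p2" "u \<noteq> 0" "h u u = 0"
    for u w
    using isotropic_pair_not_orthogonal that assms(15) span_eq[OF that(1-4)] by simp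
  have SU: "\<And>s. B s \<in> SU21 h"
    and "(elliptic h R \<and>
            (\<exists>x y. x \<in> cline p1 p2 \<and> y \<in> cline p1 p2 \<and> fixed_point R x \<and> fixed_point R y \<and> h x y = 0 \<and>
               (\<forall>s. B s x = cis (s / 2) *s x \<and> B s y = cis (- s / 2) *s y)))
        \<or> (loxodromic h R \<and>
            (\<exists>v1 v2. v1 \<in> cline p1 p2 \<and> v2 \<in> cline p1 p2 \<and> fixed_point R v1 \<and> fixed_point R v2 \<and>
               sig h v1 = 0 \<and> sig h v2 = 0 \<and> proj v1 \<noteq> proj v2 \<and>
               (\<forall>s. B s v1 = complex_of_real (exp s) *s v1 \<and>
                    B s v2 = complex_of_real (exp (- s)) *s v2)))
        \<or> (parabolic h R \<and>
            (\<exists>v1 v2. v1 \<in> cline p1 p2 \<and> v2 \<in> cline p1 p2 \<and> fixed_point R v1 \<and> sig h v1 = 0 \<and>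
               v2 \<noteq> 0 \<and> sig h v2 = 0 \<and> proj v2 \<noteq> proj v1 \<and> h v1 v2 \<in> \<real> \<and>
               (\<forall>s. B s v1 = v1 \<and> B s v2 = (\<i> * complex_of_real s) *s v1 + v2)))"
    using assms(19) unfolding bending_subgroup_def Let_def R_def by blast+
  then consider
      (ell) x y where "x \<in> cline p1 p2" "y \<in> cline p1 p2" "fixed_point R x" "fixed_point R y"
        "h x y = 0" "\<And>s. B s x = cis (s / 2) *s x" "\<And>s. B s y = cis (- s / 2) *s y"
    | (lox) u w where "u \<in> cline p1 p2" "w \<in> cline p1 p2" "fixed_point R u" "fixed_point R w"
        "sig h u = 0" "proj u \<noteq> proj w"
        "\<And>s. B s u = complex_of_real (exp s) *s u" "\<And>s. B s w = complex_of_real (exp (- s)) *s w"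
    | (par) u w where "parabolic h R" "u \<in> cline p1 p2" "w \<in> cline p1 p2" "fixed_point R u"
        "sig h u = 0" "w \<noteq> 0" "sig h w = 0" "proj w \<noteq> proj u" "h u w \<in> \<real>"
        "\<And>s. B s u = u" "\<And>s. B s w = (\<i> * complex_of_real s) *s u + w"
    by metis
  then show ?thesis
  proof cases
    case ell
    have xy0: "x \<noteq> 0" "y \<noteq> 0" using ell by (auto simp: fixed_point_def)
    \<comment> \<open>Orthogonality alone would allow \<open>x\<close> and \<open>y\<close> to be
      the same isotropic point. At parameter \<open>pi\<close>, however, \<open>B\<close> acts by
      \<open>\<i>\<close> on \<open>x\<close> and by \<open>- \<i>\<close> on
      \<open>y\<close>.\<close>
    have "proj x \<noteq> proj y"
    proof
      assume "proj x = proj y"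
      then have "y \<in> vec.span {x}" unfolding proj_def by (metis singletonI vec.span_base)
      then obtain k where k: "y = k *s x" by (auto simp: vec.span_singleton)
      interpret B: Vector_Spaces.linear "(*s)" "(*s)" "B pi" using SU by (simp add: SU21_def)
      have "cis (- pi / 2) *s y = cis (pi / 2) *s y"
        using ell(6)[of pi] ell(7)[of pi] unfolding k by (simp add: B.scale mult.commute)
      then have "cis (- pi / 2) = cis (pi / 2)" using xy0(2) by (simp only: vec.scale_right_imp_eq)
      then show False by (simp add: complex_eq_iff cis.code)
    qed
    note xy = independent_pairI[OF xy0 this]
    have yx: "vec.independent {y, x}" "y \<noteq> x" using xy by (auto simp: insert_commute)
    have "h y x = 0" using ell(5) by (metis complex_cnj_zero h_cnj)
    \<comment> \<open>An isotropic \<open>x\<close> or \<open>y\<close>, being orthogonal to the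
      other, would lie in the radical of the line.\<close>
    then have hn: "h x x \<noteq> 0" "h y y \<noteq> 0"
      using nondeg[OF xy ell(1,2) xy0(1)] nondeg[OF yx ell(2,1) xy0(2)] ell(5) by auto
    obtain a b where "g x = a *s x" "g y = b *s y" using diagonal[OF xy ell(1-4)] by blast
    from elliptic_centralizer[OF hn this] g_iso ell(1,2)
    obtain s \<kappa> where "\<kappa> \<noteq> 0" "g x = \<kappa> *s (cis (s / 2) *s x)" "g y = \<kappa> *s (cis (- s / 2) *s y)"
      by metis
    then show ?thesis using finish[OF xy ell(1,2) _ SU] ell(6,7) by metis
  next
    case lox
    have uw0: "u \<noteq> 0" "w \<noteq> 0" using lox by (auto simp: fixed_point_def)
    note uw = independent_pairI[OF uw0 lox(6)]
    have "h u w \<noteq> 0" using nondeg[OF uw lox(1,2) uw0(1)] lox(5) by (simp add: sig_eq_0_iff)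
    moreover obtain a b where "g u = a *s u" "g w = b *s w" using diagonal[OF uw lox(1-4)] by blast
    ultimately obtain s \<kappa> where "\<kappa> \<noteq> 0" "g u = \<kappa> *s (complex_of_real (exp s) *s u)"
        "g w = \<kappa> *s (complex_of_real (exp (- s)) *s w)"
      using loxodromic_centralizer g_iso lox(1,2) by metis
    then show ?thesis using finish[OF uw lox(1,2) _ SU] lox(7,8) by metis
  next
    case par
    have u0: "u \<noteq> 0" using par by (simp add: fixed_point_def)
    note uw = independent_pairI[OF u0 par(6) not_sym[OF par(8)]]
    have iso: "h u u = 0" "h w w = 0" using par by (auto simp: sig_eq_0_iff)
    have huw: "h u w \<noteq> 0" using nondeg[OF uw par(2,3) u0 iso(1)] .
    obtain \<nu> where Ru: "R u = \<nu> *s u" using par(4) by (auto simp: fixed_point_def)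
    have "R w \<in> cline p1 p2"
      using R_iso_in_span par(3) p_in unfolding R_def cline_def by simp
    then obtain \<beta> \<mu> where Rw: "R w = \<beta> *s u + \<mu> *s w"
      unfolding span_eq[OF uw par(2,3)] mem_span_pair_iff by blast
    obtain P where P: "isotropic_fixed_points h R = {P}"
      using par(1) by (auto simp: parabolic_def card_1_singleton_iff)
    have "\<exists>k. v = k *s u" if "v \<noteq> 0" "h v v = 0" "\<exists>k. R v = k *s v" for v
    proof -
      have "proj v \<in> isotropic_fixed_points h R" "proj u \<in> isotropic_fixed_points h R"
        using that par(4,5) by (auto simp: isotropic_fixed_points_def fixed_point_def sig_eq_0_iff)
      then have "proj v = proj u" using P by simp
      then have "v \<in> vec.span {u}" unfolding proj_def by (metis singletonI vec.span_base)
      then show ?thesis by (auto simp: vec.span_singleton)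
    qed
    then have \<mu>: "\<mu> = \<nu>"
      using parabolic_jordan_block[OF uw R_lin iso huw Ru Rw R_iso] by blast
    \<comment> \<open>Otherwise \<open>R\<close> would be the scalar \<open>\<nu>\<close> on the
      line.\<close>
    have "\<beta> \<noteq> 0"
      using not_scalar[OF uw par(2,3) Ru, of \<nu>] Rw \<mu> by auto
    from parabolic_centralizer[OF uw R_lin g iso(2) huw par(9) iso(1) Ru Rw[unfolded \<mu>] this]
    obtain s \<kappa> where "\<kappa> \<noteq> 0" "g u = \<kappa> *s u" "g w = \<kappa> *s ((\<i> * complex_of_real s) *s u + w)"
      using g_in commute g_iso par(2,3) unfolding span_eq[OF uw par(2,3)] by blast
    then show ?thesis using finish[OF uw par(2,3) _ SU] par(10,11) by metis
  qed
qed

end
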